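(* Let $G$ be a graph with maximum degree $\Delta$. If $\operatorname{mad}(G)<14/5$, then $\chi'_{ss}(G)\le 2\Delta+4$; and if $\operatorname{mad}(G)<8/3$, then $\chi'_{ss}(G)\le 2\Delta+2$.
   Context: Graphs are finite, undirected and simple. The maximum average degree $\operatorname{mad}(G)$ is the maximum of the average degrees of the non-empty subgraphs of $G$. A matching $M$ of $G$ is a set of pairwise disjoint edges; $G_M$ denotes the subgraph of $G$ induced by the vertices covered by $M$. An edge is pendant in a graph if at least one of its endvertices has degree $1$ in that graph. A matching $M$ of $G$ is semistrong if every edge of $M$ is pendant in $G_M$. A semistrong edge coloring of $G$ is an assignment of colors to the edges of $G$ such that every color class is a semistrong matching of $G$. The semistrong chromatic index $\chi'_{ss}(G)$ is the minimum number of colors in a semistrong edge coloring of $G$. *)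

theory Defs
  imports Complex_Main
begin

record 'a graph =
  verts :: "'a set"
  edges :: "'a set set"

text \<open>An undirected edge is the two-element set of its endvertices.\<close>

definition simple_graph :: "'a graph \<Rightarrow> bool" where
  "simple_graph G \<longleftrightarrow>
     finite (verts G) \<and> (\<forall>e\<in>edges G. e \<subseteq> verts G \<and> card e = 2)"

definition degree :: "'a graph \<Rightarrow> 'a \<Rightarrow> nat" where
  "degree G v = card {e \<in> edges G. v \<in> e}"

text \<open>For the graph without vertices, the maximum degree and the maximum average degree
  are set to 0, as \<^const>\<open>Max\<close> is unspecified on the empty set.\<close>

definition max_degree :: "'a graph \<Rightarrow> nat" where
  "max_degree G = (if verts G = {} then 0 else Max (degree G ` verts G))"

definition subgraph :: "'a graph \<Rightarrow> 'a graph \<Rightarrow> bool" where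
  "subgraph H G \<longleftrightarrow> simple_graph H \<and> verts H \<subseteq> verts G \<and> edges H \<subseteq> edges G"

definition average_degree :: "'a graph \<Rightarrow> real" where
  "average_degree G = (\<Sum>v\<in>verts G. real (degree G v)) / real (card (verts G))"

definition mad :: "'a graph \<Rightarrow> real" where
  "mad G = (if verts G = {} then 0
     else Max {average_degree H | H. subgraph H G \<and> verts H \<noteq> {}})"

definition induced_subgraph :: "'a graph \<Rightarrow> 'a set \<Rightarrow> 'a graph" where
  "induced_subgraph G U = \<lparr>verts = verts G \<inter> U, edges = {e \<in> edges G. e \<subseteq> U}\<rparr>"

definition matching :: "'a graph \<Rightarrow> 'a set set \<Rightarrow> bool" where
  "matching G M \<longleftrightarrow> M \<subseteq> edges G \<and> pairwise disjnt M"

definition pendant :: "'a graph \<Rightarrow> 'a set \<Rightarrow> bool" where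
  "pendant G e \<longleftrightarrow> e \<in> edges G \<and> (\<exists>v\<in>e. degree G v = 1)"

definition semistrong_matching :: "'a graph \<Rightarrow> 'a set set \<Rightarrow> bool" where
  "semistrong_matching G M \<longleftrightarrow>
     matching G M \<and> (\<forall>e\<in>M. pendant (induced_subgraph G (\<Union>M)) e)"

definition semistrong_edge_coloring :: "'a graph \<Rightarrow> nat \<Rightarrow> ('a set \<Rightarrow> nat) \<Rightarrow> bool" where
  "semistrong_edge_coloring G k c \<longleftrightarrow>
     c ` edges G \<subseteq> {..<k} \<and> (\<forall>i<k. semistrong_matching G {e \<in> edges G. c e = i})"

definition semistrong_chromatic_index :: "'a graph \<Rightarrow> nat" where
  "semistrong_chromatic_index G = (LEAST k. \<exists>c. semistrong_edge_coloring G k c)"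

text \<open>The maximum and the minimum above are attained.\<close>

lemma finite_edges: "simple_graph G \<Longrightarrow> finite (edges G)"
  by (rule finite_subset[of _ "Pow (verts G)"]) (auto simp: simple_graph_def)

lemma finite_subgraphs:
  assumes "simple_graph G"
  shows "finite {H. subgraph H G}"
proof (rule finite_subset)
  show "{H. subgraph H G} \<subseteq> (\<lambda>(V, E). \<lparr>verts = V, edges = E\<rparr>) ` (Pow (verts G) \<times> Pow (edges G))"
  proof
    fix H assume "H \<in> {H. subgraph H G}"
    then have "H = (\<lambda>(V, E). \<lparr>verts = V, edges = E\<rparr>) (verts H, edges H)"
      and "(verts H, edges H) \<in> Pow (verts G) \<times> Pow (edges G)"
      by (auto simp: subgraph_def)
    then show "H \<in> (\<lambda>(V, E). \<lparr>verts = V, edges = E\<rparr>) ` (Pow (verts G) \<times> Pow (edges G))"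
      by (rule image_eqI)
  qed
  show "finite ((\<lambda>(V, E). \<lparr>verts = V, edges = E\<rparr>) ` (Pow (verts G) \<times> Pow (edges G)))"
    using assms finite_edges[OF assms] by (simp add: simple_graph_def)
qed

lemma mad_attained:
  assumes "simple_graph G" "verts G \<noteq> {}"
  obtains H where "subgraph H G" "verts H \<noteq> {}" "mad G = average_degree H"
proof -
  let ?A = "{average_degree H | H. subgraph H G \<and> verts H \<noteq> {}}"
  have "finite ?A"
    using finite_subgraphs[OF assms(1)] by simp
  moreover have "average_degree G \<in> ?A"
    using assms by (auto simp: subgraph_def)
  ultimately have "Max ?A \<in> ?A"
    by (intro Max_in) auto
  then show thesis
    using that assms(2) unfolding mad_def by auto
qed

lemma semistrong_matching_single:
  assumes "simple_graph G" "e \<in> edges G"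
  shows "semistrong_matching G {e}"
proof -
  have e: "card e = 2" using assms by (auto simp: simple_graph_def)
  then obtain v where v: "v \<in> e" by fastforce
  have "e' = e" if "e' \<in> edges G" "e' \<subseteq> e" for e'
  proof (rule card_subset_eq)
    show "finite e"
      using e by (simp add: card_ge_0_finite)
    show "card e' = card e"
      using that assms by (simp add: simple_graph_def)
  qed (fact that)
  then have "{e' \<in> edges G. e' \<subseteq> e} = {e}"
    using assms(2) by auto
  then have "{e' \<in> edges (induced_subgraph G e). v \<in> e'} = {e}"
    using v by (auto simp: induced_subgraph_def)
  then have "degree (induced_subgraph G e) v = 1"
    by (simp add: degree_def)
  then have "pendant (induced_subgraph G e) e"
    using v assms(2) by (auto simp: pendant_def induced_subgraph_def)
  then show ?thesis
    using assms(2) by (simp add: semistrong_matching_def matching_def)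
qed

lemma semistrong_edge_coloring_exists:
  assumes "simple_graph G"
  obtains c where "semistrong_edge_coloring G (semistrong_chromatic_index G) c"
proof -
  obtain c :: "'a set \<Rightarrow> nat" where c: "bij_betw c (edges G) {0..<card (edges G)}"
    using ex_bij_betw_finite_nat[OF finite_edges[OF assms]] by blast
  have "semistrong_edge_coloring G (card (edges G)) c"
    unfolding semistrong_edge_coloring_def
  proof (intro conjI allI impI)
    show "c ` edges G \<subseteq> {..<card (edges G)}"
      using c by (auto simp: bij_betw_def)
    fix i assume "i < card (edges G)"
    then have "i \<in> c ` edges G"
      using c by (simp add: bij_betw_def)
    then obtain e where e: "e \<in> edges G" "c e = i"
      by blast
    have "{e \<in> edges G. c e = i} = {e}"
      using e c by (auto simp: bij_betw_def inj_on_def)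
    then show "semistrong_matching G {e \<in> edges G. c e = i}"
      using semistrong_matching_single[OF assms e(1)] by simp
  qed
  then have "\<exists>c. semistrong_edge_coloring G (semistrong_chromatic_index G) c"
    unfolding semistrong_chromatic_index_def
    by (intro LeastI[of "\<lambda>k. \<exists>c. semistrong_edge_coloring G k c"] exI)
  then show thesis
    using that by blast
qed

end

theory Submission
  imports Defs
begin

text \<open>
  The argument is a discharging proof on a strengthened notion of colouring. Every edge
  \<open>e\<close> is given a tail, one of its two ends, which is promised to be the end of degree 1 that
  makes \<open>e\<close> pendant: no other edge with the colour of \<open>e\<close> may meet the closed neighbourhood
  of the tail. Such a colouring is a semistrong edge colouring
  (\<open>semistrong_if_tail_colouring\<close>), and the conflicts between edges are now pairwise, so that it
  can be extended greedily.

  Let a new edge \<open>vp\<close> join a new vertex \<open>v\<close>, its tail, to an old vertex \<open>p\<close>. Apart from the few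
  edges at other neighbours of \<open>v\<close>, it is in conflict with the old edges at \<open>p\<close> and with
  those whose tail is adjacent to \<open>p\<close>. These are few if each vertex is the tail of at most two
  edges: a neighbour \<open>x\<close> of \<open>p\<close> contributes at most one edge outside the star of \<open>p\<close>,
  unless \<open>px\<close> has tail \<open>p\<close> and \<open>x\<close> is the tail of two edges. If each vertex has at most \<open>h\<close> such
  neighbours, then at most \<open>2 (\<Delta> - 1) + h\<close> old edges are in conflict with \<open>vp\<close> because of \<open>p\<close>
  (\<open>card_near\<close>). New edges always get new vertices as tails, so the condition on the tails is easy
  to maintain.

  With \<open>h = 2\<close> and \<open>2 \<Delta> + 4\<close> colours one may add a vertex of degree 1, or a vertex of degree 2 with
  a neighbour \<open>w\<close> of degree at most 3, or of degree 4 with only neighbours of degree 2. If none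
  of these exists, every vertex of degree 2 can receive \<open>2/5\<close> from each of its neighbours, and
  the average degree is at least \<open>14/5\<close>. With \<open>h = 1\<close> and \<open>2 \<Delta> + 2\<close> colours one may add a vertex
  of degree 1, a vertex of degree 2 with a neighbour of degree 2, or a vertex of degree 3 together
  with two neighbours of degree 2. If none of these exists, every vertex of degree 2 can receive
  \<open>1/3\<close> from each of its neighbours, and the average degree is at least \<open>8/3\<close>.

  A graph is represented by its edges alone; its vertices are then those of positive degree. Sparsity
  and degree bounds are inherited by subsets of the edges, while the colourings are extended from
  the subgraph induced by the complement of a set \<open>X\<close> of vertices, whose edges are \<open>avoiding E X\<close>.
\<close>

section \<open>Edge sets\<close>

definition edge_set :: "'a set set \<Rightarrow> bool" where
  "edge_set E \<longleftrightarrow> finite E \<and> (\<forall>e\<in>E. card e = 2)"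

definition star :: "'a set set \<Rightarrow> 'a \<Rightarrow> 'a set set" where
  "star E x = {e \<in> E. x \<in> e}"

definition nbrs :: "'a set set \<Rightarrow> 'a \<Rightarrow> 'a set" where
  "nbrs E x = {y. {x, y} \<in> E}"

definition avoiding :: "'a set set \<Rightarrow> 'a set \<Rightarrow> 'a set set" where
  "avoiding E X = {e \<in> E. e \<inter> X = {}}"

lemma finite_star: "edge_set E \<Longrightarrow> finite (star E x)"
  by (simp add: edge_set_def star_def)

lemma nbrs_sym: "y \<in> nbrs E x \<longleftrightarrow> x \<in> nbrs E y"
  by (simp add: nbrs_def insert_commute)

lemma nbrs_irrefl: "edge_set E \<Longrightarrow> y \<in> nbrs E x \<Longrightarrow> y \<noteq> x"
  by (auto simp: edge_set_def nbrs_def)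

lemma edge_doubleton:
  assumes "edge_set E" "e \<in> E" "x \<in> e"
  obtains y where "e = {x, y}" "x \<noteq> y" "y \<in> nbrs E x"
proof -
  have "card e = 2" using assms by (simp add: edge_set_def)
  then obtain a b where ab: "e = {a, b}" "a \<noteq> b" by (meson card_2_iff)
  show thesis
  proof (cases "x = a")
    case True
    then show thesis using that[of b] ab assms(2) by (auto simp: nbrs_def)
  next
    case False
    then show thesis using that[of a] ab assms(2,3) by (auto simp: nbrs_def insert_commute)
  qed
qed

lemma star_eq_image: "edge_set E \<Longrightarrow> star E x = (\<lambda>y. {x, y}) ` nbrs E x"
  by (auto simp: star_def nbrs_def elim: edge_doubleton)

lemma card_nbrs: "edge_set E \<Longrightarrow> card (nbrs E x) = card (star E x)"
  by (simp add: star_eq_image card_image inj_on_def doubleton_eq_iff)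

lemma finite_nbrs: "edge_set E \<Longrightarrow> finite (nbrs E x)"
  using finite_star[of E x]
  by (simp add: star_eq_image finite_image_iff inj_on_def doubleton_eq_iff)

lemma obtain_other_nbr:
  assumes E: "edge_set E" and u: "card (star E u) = 2" "w \<in> nbrs E u"
  obtains p where "nbrs E u = {p, w}" "p \<noteq> w" "p \<noteq> u" "w \<noteq> u"
proof -
  have "card (nbrs E u - {w}) = 1"
    using u by (simp add: card_nbrs[OF E] finite_nbrs[OF E])
  then obtain p where p: "nbrs E u - {w} = {p}" by (auto simp: card_1_singleton_iff)
  then have "nbrs E u = {p, w}" using u(2) by blast
  then show thesis using that[of p] p nbrs_irrefl[OF E, of _ u] by blast
qed

lemma edge_set_avoiding: "edge_set E \<Longrightarrow> edge_set (avoiding E X)"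
  by (simp add: edge_set_def avoiding_def)

lemma nbrs_avoiding: "nbrs (avoiding E X) x = (if x \<in> X then {} else nbrs E x - X)"
  by (auto simp: nbrs_def avoiding_def)

lemma star_avoiding_eq_empty: "x \<in> X \<Longrightarrow> star (avoiding E X) x = {}"
  by (auto simp: star_def avoiding_def)

lemma card_star_avoiding_less:
  assumes "edge_set E" "y \<in> nbrs E p" "y \<in> X"
  shows "card (star (avoiding E X) p) < card (star E p)"
proof (rule psubset_card_mono)
  show "finite (star E p)" using assms(1) by (rule finite_star)
  have "{p, y} \<in> star E p - star (avoiding E X) p"
    using assms by (auto simp: star_def avoiding_def nbrs_def)
  moreover have "star (avoiding E X) p \<subseteq> star E p"
    by (auto simp: star_def avoiding_def)
  ultimately show "star (avoiding E X) p \<subset> star E p"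
    by blast
qed

lemma card_star_avoiding_add_2:
  assumes "edge_set E" "y \<in> nbrs E p" "y \<in> X" "z \<in> nbrs E p" "z \<in> X" "y \<noteq> z"
  shows "card (star (avoiding E X) p) + 2 \<le> card (star E p)"
proof -
  have "star (avoiding E X) p \<subseteq> star E p - {{p, y}, {p, z}}"
    using assms by (auto simp: star_def avoiding_def)
  moreover have "{{p, y}, {p, z}} \<subseteq> star E p"
    using assms by (auto simp: star_def nbrs_def)
  moreover have "card {{p, y}, {p, z}} = 2"
    using assms(6) by (simp add: doubleton_eq_iff)
  ultimately show ?thesis
    using finite_star[OF assms(1), of p]
    by (metis Nat.le_diff_conv2 card_Diff_subset card_mono finite.emptyI finite_Diff finite_insert)
qed

section \<open>Tail colourings\<close>

text \<open>
  The edge \<open>f\<close> violates the promise that \<open>t e\<close> is a pendant end of \<open>e\<close> if both get the same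
  colour. The relation is not symmetric. It holds whenever \<open>e\<close> and \<open>f\<close> share an end, because
  the other end of \<open>e\<close> is a neighbour of its tail.
\<close>

definition conflict :: "'a set set \<Rightarrow> ('a set \<Rightarrow> 'a) \<Rightarrow> 'a set \<Rightarrow> 'a set \<Rightarrow> bool" where
  "conflict E t e f \<longleftrightarrow> (\<exists>y\<in>f. y = t e \<or> y \<in> nbrs E (t e))"

definition tail_colouring :: "'a set set \<Rightarrow> ('a set \<Rightarrow> 'a) \<Rightarrow> ('a set \<Rightarrow> nat) \<Rightarrow> bool" where
  "tail_colouring E t c \<longleftrightarrow> (\<forall>e\<in>E. t e \<in> e) \<and>
     (\<forall>e\<in>E. \<forall>f\<in>E. e \<noteq> f \<and> conflict E t e f \<longrightarrow> c e \<noteq> c f)"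

lemma tail_colouringD:
  assumes "tail_colouring E t c" "e \<in> E" "f \<in> E" "e \<noteq> f" "conflict E t e f"
  shows "c e \<noteq> c f"
  using assms by (simp add: tail_colouring_def)

text \<open>
  Let \<open>M\<close> be a colour class. An edge of the subgraph induced by the ends of \<open>M\<close> which contains the
  tail of \<open>e \<in> M\<close> leads to a neighbour of the tail that is covered by \<open>M\<close>; the edge of \<open>M\<close> covering it
  can only be \<open>e\<close>. So the tail has degree 1 there.
\<close>

lemma semistrong_if_tail_colouring:
  assumes G: "simple_graph G" and c: "tail_colouring (edges G) t c" "c ` edges G \<subseteq> {..<k}"
  shows "semistrong_edge_coloring G k c"
  unfolding semistrong_edge_coloring_def
proof (intro conjI allI impI)
  show "c ` edges G \<subseteq> {..<k}" by fact
  have E: "edge_set (edges G)"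
    using G finite_edges[OF G] by (simp add: edge_set_def simple_graph_def)
  fix i assume "i < k"
  define M where "M = {e \<in> edges G. c e = i}"
  have tail: "t e \<in> e" if "e \<in> edges G" for e
    using that c by (simp add: tail_colouring_def)
  have same: "f = e" if "e \<in> M" "f \<in> M" "y \<in> f" "y = t e \<or> y \<in> nbrs (edges G) (t e)" for e f y
  proof (rule ccontr)
    assume "f \<noteq> e"
    moreover have "conflict (edges G) t e f" using that(3,4) by (auto simp: conflict_def)
    moreover have "e \<in> edges G" "f \<in> edges G" "c e = c f" using that(1,2) by (simp_all add: M_def)
    ultimately show False using tail_colouringD[OF c(1), of e f] by simp
  qed
  have "disjnt e f" if ef: "e \<in> M" "f \<in> M" "e \<noteq> f" for e f
  proof (rule ccontr)
    assume "\<not> disjnt e f"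
    then obtain y where y: "y \<in> e" "y \<in> f" by (auto simp: disjnt_def)
    have "e \<in> edges G" using ef by (simp add: M_def)
    then obtain z where "e = {t e, z}" "z \<in> nbrs (edges G) (t e)"
      using edge_doubleton[OF E _ tail] by metis
    then show False using same[OF ef(1,2) y(2)] y(1) ef(3) by blast
  qed
  moreover have "pendant (induced_subgraph G (\<Union>M)) e" if e: "e \<in> M" for e
  proof -
    have eG: "e \<in> edges G" using e by (simp add: M_def)
    have "g = e" if g: "g \<in> edges G" "g \<subseteq> \<Union>M" "t e \<in> g" for g
    proof -
      obtain y where y: "g = {t e, y}" "t e \<noteq> y" "y \<in> nbrs (edges G) (t e)"
        using edge_doubleton[OF E g(1,3)] .
      then obtain f where f: "f \<in> M" "y \<in> f" using g(2) by blast
      then have "y \<in> e" using same[OF e f(1,2)] y(3) by blast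
      then have "g \<subseteq> e" using y tail[OF eG] by simp
      moreover have "card g = card e" "finite e"
        using E eG g(1) by (auto simp: edge_set_def card_ge_0_finite)
      ultimately show "g = e" by (simp add: card_subset_eq)
    qed
    then have "{g \<in> edges (induced_subgraph G (\<Union>M)). t e \<in> g} = {e}"
      using e eG tail[OF eG] by (auto simp: induced_subgraph_def)
    then have "degree (induced_subgraph G (\<Union>M)) (t e) = 1"
      by (simp add: degree_def)
    moreover have "e \<in> edges (induced_subgraph G (\<Union>M))"
      using e eG by (auto simp: induced_subgraph_def)
    ultimately show ?thesis
      using tail[OF eG] by (auto simp: pendant_def)
  qed
  ultimately have "semistrong_matching G M"
    by (auto simp: semistrong_matching_def matching_def pairwise_def M_def)
  then show "semistrong_matching G {e \<in> edges G. c e = i}" by (simp add: M_def)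
qed

section \<open>Counting the edges near a vertex\<close>

text \<open>
  The edges are thought of as arcs leaving their tails, and \<open>out E t x\<close> is the set of arcs leaving \<open>x\<close>.
  An out-neighbour is busy if it has the largest admitted out-degree, which is 2. The value
  \<open>h = 2\<close> expresses the out-degree bound alone; \<open>h = 1\<close> saves one more colour at each vertex.
\<close>

definition out :: "'a set set \<Rightarrow> ('a set \<Rightarrow> 'a) \<Rightarrow> 'a \<Rightarrow> 'a set set" where
  "out E t x = {e \<in> E. t e = x}"

definition busy_out_nbrs :: "'a set set \<Rightarrow> ('a set \<Rightarrow> 'a) \<Rightarrow> 'a \<Rightarrow> 'a set" where
  "busy_out_nbrs E t x = {y \<in> nbrs E x. t {x, y} = x \<and> card (out E t y) = 2}"

definition few_out :: "nat \<Rightarrow> 'a set set \<Rightarrow> ('a set \<Rightarrow> 'a) \<Rightarrow> bool" where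
  "few_out h E t \<longleftrightarrow> (\<forall>x. card (out E t x) \<le> 2 \<and> card (busy_out_nbrs E t x) \<le> h)"

text \<open>
  The colours on these edges are the ones that the end \<open>p\<close> of a new edge forbids, if the other end is a
  new vertex.
\<close>

definition near :: "'a set set \<Rightarrow> ('a set \<Rightarrow> 'a) \<Rightarrow> 'a \<Rightarrow> 'a set set" where
  "near E t p = star E p \<union> (\<Union>x\<in>nbrs E p. out E t x)"

lemma finite_out: "edge_set E \<Longrightarrow> finite (out E t x)"
  by (simp add: edge_set_def out_def)

lemma finite_near: "edge_set E \<Longrightarrow> finite (near E t p)"
  by (simp add: near_def finite_star finite_nbrs finite_out)

lemma out_subset_star: "\<forall>e\<in>E. t e \<in> e \<Longrightarrow> out E t x \<subseteq> star E x"
  by (auto simp: out_def star_def)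

lemma card_near_le_sum:
  assumes "edge_set E"
  shows "card (near E t p) \<le> card (star E p) + (\<Sum>x\<in>nbrs E p. card (out E t x - star E p))"
proof -
  have "near E t p = star E p \<union> (\<Union>x\<in>nbrs E p. out E t x - star E p)"
    by (auto simp: near_def)
  then have "card (near E t p) \<le> card (star E p) + card (\<Union>x\<in>nbrs E p. out E t x - star E p)"
    by (metis card_Un_le)
  also have "card (\<Union>x\<in>nbrs E p. out E t x - star E p) \<le> (\<Sum>x\<in>nbrs E p. card (out E t x - star E p))"
    by (rule card_UN_le[OF finite_nbrs[OF assms]])
  finally show ?thesis by simp
qed

text \<open>
  Besides the star of \<open>p\<close>, each neighbour \<open>x\<close> contributes the arcs that leave \<open>x\<close> without reaching
  \<open>p\<close>. If the edge \<open>px\<close> leaves \<open>x\<close>, it uses up one of the two arcs at \<open>x\<close>; if it leaves \<open>p\<close>, then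
  two arcs remain only at a busy out-neighbour.
\<close>

lemma card_near:
  assumes E: "edge_set E" and t: "\<forall>e\<in>E. t e \<in> e" and few: "few_out h E t"
  shows "card (near E t p) \<le> 2 * card (star E p) + h"
proof -
  let ?B = "busy_out_nbrs E t p"
  have "card (out E t x - star E p) \<le> 1 + (if x \<in> ?B then 1 else 0)" if x: "x \<in> nbrs E p" for x
  proof (cases "t {p, x} = p")
    case True
    have "card (out E t x - star E p) \<le> card (out E t x)"
      by (simp add: card_mono finite_out[OF E])
    moreover have "card (out E t x) \<le> 2" using few by (simp add: few_out_def)
    ultimately show ?thesis using True x by (auto simp: busy_out_nbrs_def)
  next
    case False
    have px: "{p, x} \<in> E" using x by (simp add: nbrs_def)
    then have "{p, x} \<in> out E t x" using False t by (auto simp: out_def)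
    moreover have "{p, x} \<in> star E p" using px by (simp add: star_def)
    ultimately have "out E t x - star E p \<subset> out E t x" by blast
    then have "card (out E t x - star E p) < card (out E t x)"
      by (rule psubset_card_mono[OF finite_out[OF E]])
    moreover have "card (out E t x) \<le> 2" using few by (simp add: few_out_def)
    ultimately show ?thesis by simp
  qed
  then have "(\<Sum>x\<in>nbrs E p. card (out E t x - star E p)) \<le>
      (\<Sum>x\<in>nbrs E p. 1 + (if x \<in> ?B then 1 else 0))"
    by (rule sum_mono)
  also have "\<dots> = card (nbrs E p) + card (nbrs E p \<inter> ?B)"
    by (simp only: sum.distrib sum.If_cases[OF finite_nbrs[OF E]]) simp
  also have "nbrs E p \<inter> ?B = ?B"
    by (auto simp: busy_out_nbrs_def)
  also have "card ?B \<le> h" using few by (simp add: few_out_def)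
  finally have "(\<Sum>x\<in>nbrs E p. card (out E t x - star E p)) \<le> card (star E p) + h"
    by (simp add: card_nbrs[OF E])
  then show ?thesis using card_near_le_sum[OF E, of t p] by simp
qed

text \<open>
  If \<open>x\<close> has degree at most 2, it has only one edge besides \<open>px\<close>, whatever the tails are.
\<close>

lemma card_near_of_thin_nbrs:
  assumes E: "edge_set E" and t: "\<forall>e\<in>E. t e \<in> e"
    and thin: "\<And>x. x \<in> nbrs E p \<Longrightarrow> card (star E x) \<le> 2"
  shows "card (near E t p) \<le> 2 * card (star E p)"
proof -
  have "card (out E t x - star E p) \<le> 1" if x: "x \<in> nbrs E p" for x
  proof -
    have "{p, x} \<in> star E x" "{p, x} \<in> star E p" using x by (auto simp: nbrs_def star_def)
    then have "out E t x - star E p \<subset> star E x"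
      using out_subset_star[OF t, of x] by blast
    then have "card (out E t x - star E p) < card (star E x)"
      by (rule psubset_card_mono[OF finite_star[OF E]])
    then show ?thesis using thin[OF x] by simp
  qed
  then have "(\<Sum>x\<in>nbrs E p. card (out E t x - star E p)) \<le> (\<Sum>x\<in>nbrs E p. 1)"
    by (rule sum_mono)
  then show ?thesis using card_near_le_sum[OF E, of t p] by (simp add: card_nbrs[OF E])
qed

section \<open>Extending a tail colouring\<close>

text \<open>
  The old edges whose colours the new edge \<open>d\<close> has to avoid. The conflicts are taken in the large
  graph, where a new vertex may be a neighbour of a tail.
\<close>

definition forbidden ::
    "'a set set \<Rightarrow> 'a set \<Rightarrow> ('a set \<Rightarrow> 'a) \<Rightarrow> 'a set \<Rightarrow> 'a set set" where
  "forbidden E X t d = {f \<in> avoiding E X. conflict E t d f \<or> conflict E t f d}"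

lemma tail_colouring_extend:
  assumes old: "tail_colouring (avoiding E X) t c"
    and tail: "\<And>d. d \<in> E - avoiding E X \<Longrightarrow> t d \<in> d"
    and agree: "\<And>e. e \<in> avoiding E X \<Longrightarrow> c' e = c e"
    and old_new: "\<And>d f. d \<in> E - avoiding E X \<Longrightarrow> f \<in> forbidden E X t d \<Longrightarrow> c' d \<noteq> c f"
    and new: "\<And>d d'. d \<in> E - avoiding E X \<Longrightarrow> d' \<in> E - avoiding E X \<Longrightarrow> d \<noteq> d' \<Longrightarrow>
      conflict E t d d' \<Longrightarrow> c' d \<noteq> c' d'"
  shows "tail_colouring E t c'"
  unfolding tail_colouring_def
proof (intro conjI ballI impI)
  fix e assume "e \<in> E"
  then show "t e \<in> e"
    using old tail by (cases "e \<in> avoiding E X") (auto simp: tail_colouring_def)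
next
  fix e f assume ef: "e \<in> E" "f \<in> E" "e \<noteq> f \<and> conflict E t e f"
  consider "e \<in> avoiding E X" "f \<in> avoiding E X" | "e \<in> avoiding E X" "f \<notin> avoiding E X"
    | "e \<notin> avoiding E X" "f \<in> avoiding E X" | "e \<notin> avoiding E X" "f \<notin> avoiding E X" by blast
  then show "c' e \<noteq> c' f"
  proof cases
    case 1
    have "t e \<in> e" using old 1 by (simp add: tail_colouring_def)
    then have "t e \<notin> X" using 1 by (auto simp: avoiding_def)
    moreover have "f \<inter> X = {}" using 1 by (simp add: avoiding_def)
    ultimately have "conflict (avoiding E X) t e f"
      using ef by (auto simp: conflict_def nbrs_avoiding)
    then show ?thesis using 1 ef old by (simp add: agree tail_colouring_def)
  next
    case 2
    then have "e \<in> forbidden E X t f" using ef by (simp add: forbidden_def)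
    then show ?thesis using old_new[of f e] 2 ef agree[of e] by auto
  next
    case 3
    then have "f \<in> forbidden E X t e" using ef by (simp add: forbidden_def)
    then show ?thesis using old_new[of e f] 3 ef agree[of f] by auto
  next
    case 4
    then show ?thesis using new[of e f] ef by blast
  qed
qed

lemma out_avoiding:
  assumes "\<forall>d\<in>E - avoiding E X. t d \<in> X" "y \<notin> X"
  shows "out E t y = out (avoiding E X) t y"
  using assms by (auto simp: out_def avoiding_def)

lemma tail_in_edge_extend:
  assumes "E - avoiding E X = D" "\<forall>e\<in>avoiding E X. t e \<in> e" "\<forall>d\<in>D. t d \<in> d"
  shows "\<forall>e\<in>E. t e \<in> e"
  using assms by blast

text \<open>
  An arc leaving an old vertex is old and leads to an old vertex, since all new arcs leave new
  vertices. So the condition at old vertices is inherited.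
\<close>

lemma few_out_extend:
  assumes old: "few_out h (avoiding E X) t"
    and tail: "\<And>d. d \<in> E - avoiding E X \<Longrightarrow> t d \<in> X"
    and new: "\<And>x. x \<in> X \<Longrightarrow> card (out E t x) \<le> 2 \<and> card (busy_out_nbrs E t x) \<le> h"
  shows "few_out h E t"
  unfolding few_out_def
proof
  fix x
  have out: "out E t y = out (avoiding E X) t y" if "y \<notin> X" for y
    using that tail by (intro out_avoiding) blast+
  show "card (out E t x) \<le> 2 \<and> card (busy_out_nbrs E t x) \<le> h"
  proof (cases "x \<in> X")
    case True
    then show ?thesis by (rule new)
  next
    case False
    have "y \<notin> X" if "y \<in> nbrs E x" "t {x, y} = x" for y
      using tail[of "{x, y}"] that False by (auto simp: nbrs_def avoiding_def)
    then have "busy_out_nbrs E t x = busy_out_nbrs (avoiding E X) t x"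
      using False out by (auto simp: busy_out_nbrs_def nbrs_avoiding)
    then show ?thesis using old out[OF False] by (simp add: few_out_def)
  qed
qed

text \<open>
  An old edge in conflict with \<open>ab\<close> either meets a neighbour of the new vertex \<open>a\<close>, or leaves a
  neighbour of \<open>b\<close>; if its tail is adjacent to \<open>a\<close> instead, then the tail itself is the vertex met.
\<close>

lemma forbidden_subset:
  assumes t: "\<forall>e\<in>avoiding E X. t e \<in> e" and d: "{a, b} \<in> E" "t {a, b} = a" "a \<in> X"
  shows "forbidden E X t {a, b} \<subseteq>
    (\<Union>y\<in>nbrs E a. star (avoiding E X) y) \<union> (\<Union>x\<in>nbrs E b. out (avoiding E X) t x)"
proof
  fix f assume f: "f \<in> forbidden E X t {a, b}"
  then have fE: "f \<in> avoiding E X" by (simp add: forbidden_def)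
  then have fX: "f \<inter> X = {}" and tf: "t f \<in> f" using t by (auto simp: avoiding_def)
  have b: "b \<in> nbrs E a" using d by (simp add: nbrs_def)
  from f consider "conflict E t {a, b} f" | "conflict E t f {a, b}" by (auto simp: forbidden_def)
  then show "f \<in> (\<Union>y\<in>nbrs E a. star (avoiding E X) y) \<union> (\<Union>x\<in>nbrs E b. out (avoiding E X) t x)"
  proof cases
    case 1
    then obtain y where "y \<in> f" "y = a \<or> y \<in> nbrs E a" using d by (auto simp: conflict_def)
    then show ?thesis using fE fX d(3) by (auto simp: star_def)
  next
    case 2
    then consider "a = t f" | "b = t f" | "a \<in> nbrs E (t f)" | "b \<in> nbrs E (t f)"
      by (auto simp: conflict_def)
    then show ?thesis
    proof cases
      case 1
      then show ?thesis using tf fX d(3) by auto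
    next
      case 2
      then show ?thesis using tf fE b by (auto simp: star_def)
    next
      case 3
      then show ?thesis using tf fE nbrs_sym[of a] by (auto simp: star_def)
    next
      case 4
      then show ?thesis using fE nbrs_sym[of b] by (auto simp: out_def)
    qed
  qed
qed

lemma forbidden_subset_near:
  assumes t: "\<forall>e\<in>avoiding E X. t e \<in> e"
    and d: "{v, p} \<in> E" "t {v, p} = v" "v \<in> X" "p \<notin> X"
  shows "forbidden E X t {v, p} \<subseteq>
    near (avoiding E X) t p \<union> (\<Union>y\<in>nbrs E v - {p}. star (avoiding E X) y)"
proof -
  have "out (avoiding E X) t x \<subseteq> near (avoiding E X) t p" if "x \<in> nbrs E p" for x
  proof (cases "x \<in> X")
    case True
    then show ?thesis using t by (fastforce simp: out_def avoiding_def)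
  next
    case False
    then show ?thesis using that d(4) by (auto simp: near_def nbrs_avoiding)
  qed
  then show ?thesis
    using forbidden_subset[OF t d(1,2,3)] by (fastforce simp: near_def)
qed

lemma few_out_cong:
  assumes "\<And>e. e \<in> E \<Longrightarrow> t e = s e"
  shows "few_out h E t \<longleftrightarrow> few_out h E s"
proof -
  have out: "out E t x = out E s x" for x using assms by (auto simp: out_def)
  have "busy_out_nbrs E t x = busy_out_nbrs E s x" for x
    using assms by (auto simp: busy_out_nbrs_def out nbrs_def)
  then show ?thesis by (simp add: few_out_def out)
qed

lemma tail_colouring_cong:
  assumes "\<And>e. e \<in> E \<Longrightarrow> t e = s e"
  shows "tail_colouring E t c \<longleftrightarrow> tail_colouring E s c"
  using assms by (simp add: tail_colouring_def conflict_def)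

text \<open>
  The out-degree condition is part of the induction hypothesis: it makes the next extension possible.
\<close>

definition colourable :: "nat \<Rightarrow> nat \<Rightarrow> 'a set set \<Rightarrow> bool" where
  "colourable K h E \<longleftrightarrow>
     (\<exists>t c. tail_colouring E t c \<and> few_out h E t \<and> c ` E \<subseteq> {..<K})"

text \<open>
  The tails of the edges to be added can be prescribed, as the colouring of the smaller graph depends
  only on its own edges.
\<close>

lemma colourableE:
  assumes "colourable K h (avoiding E X)"
  obtains t c where "\<And>e. e \<notin> avoiding E X \<Longrightarrow> t e = t0 e"
    "tail_colouring (avoiding E X) t c" "few_out h (avoiding E X) t"
    "c ` avoiding E X \<subseteq> {..<K}"
proof -
  obtain s c where sc: "tail_colouring (avoiding E X) s c" "few_out h (avoiding E X) s"
    "c ` avoiding E X \<subseteq> {..<K}"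
    using assms by (auto simp: colourable_def)
  define t where "t e = (if e \<in> avoiding E X then s e else t0 e)" for e
  have "t e = s e" if "e \<in> avoiding E X" for e using that by (simp add: t_def)
  then have "tail_colouring (avoiding E X) t c" "few_out h (avoiding E X) t"
    using sc tail_colouring_cong few_out_cong by metis+
  then show thesis using that[of t c] sc(3) by (simp add: t_def)
qed

definition palette ::
    "nat \<Rightarrow> 'a set set \<Rightarrow> 'a set \<Rightarrow> ('a set \<Rightarrow> 'a) \<Rightarrow> ('a set \<Rightarrow> nat) \<Rightarrow> 'a set \<Rightarrow> nat set" where
  "palette K E X t c d = {..<K} - c ` forbidden E X t d"

lemma card_palette:
  assumes "edge_set E" "forbidden E X t d \<subseteq> A" "finite A" "card A \<le> n"
  shows "K - n \<le> card (palette K E X t c d)"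
proof -
  have fin: "finite (forbidden E X t d)" using finite_subset[OF assms(2,3)] .
  have "card (c ` forbidden E X t d) \<le> card (forbidden E X t d)" using fin by (rule card_image_le)
  also have "\<dots> \<le> card A" using assms by (intro card_mono)
  also have "\<dots> \<le> n" by fact
  finally have "K - n \<le> card {..<K} - card (c ` forbidden E X t d)" by simp
  also have "\<dots> \<le> card (palette K E X t c d)"
    unfolding palette_def using fin by (intro diff_card_le_card_Diff) simp
  finally show ?thesis .
qed

lemma card_palette_near:
  assumes "edge_set E" "\<forall>e\<in>avoiding E X. t e \<in> e" "few_out h (avoiding E X) t"
    and "forbidden E X t d \<subseteq> near (avoiding E X) t p"
  shows "K - (2 * card (star (avoiding E X) p) + h) \<le> card (palette K E X t c d)"
  using assms card_palette finite_near card_near edge_set_avoiding by metis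

lemma colourable_extend:
  assumes old: "tail_colouring (avoiding E X) t c" "few_out h (avoiding E X) t"
      "c ` avoiding E X \<subseteq> {..<K}"
    and D: "E - avoiding E X = D"
    and tail: "\<And>d. d \<in> D \<Longrightarrow> t d \<in> d \<and> t d \<in> X"
    and out: "\<And>x. x \<in> X \<Longrightarrow> card (out E t x) \<le> 2 \<and> card (busy_out_nbrs E t x) \<le> h"
    and palette: "\<And>d. d \<in> D \<Longrightarrow> g d \<in> palette K E X t c d"
    and new: "\<And>d d'. d \<in> D \<Longrightarrow> d' \<in> D \<Longrightarrow> d \<noteq> d' \<Longrightarrow> conflict E t d d' \<Longrightarrow> g d \<noteq> g d'"
  shows "colourable K h E"
proof -
  define c' where "c' e = (if e \<in> avoiding E X then c e else g e)" for e
  have new_edge: "c' d = g d" if "d \<in> D" for d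
    using that D by (auto simp: c'_def)
  have "tail_colouring E t c'"
  proof (rule tail_colouring_extend[OF old(1)], unfold D)
    show "c' e = c e" if "e \<in> avoiding E X" for e using that by (simp add: c'_def)
    show "c' d \<noteq> c f" if "d \<in> D" "f \<in> forbidden E X t d" for d f
      using palette[OF that(1)] that by (auto simp: new_edge palette_def)
    show "c' d \<noteq> c' d'" if "d \<in> D" "d' \<in> D" "d \<noteq> d'" "conflict E t d d'" for d d'
      using new[OF that] that by (simp add: new_edge)
  qed (use tail in blast)
  moreover have "few_out h E t"
    using tail D by (intro few_out_extend[OF old(2) _ out]) blast+
  moreover have "c' e < K" if "e \<in> E" for e
  proof (cases "e \<in> avoiding E X")
    case True
    then show ?thesis using old(3) by (auto simp: c'_def)
  next
    case False
    then have "e \<in> D" using D that by blast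
    then show ?thesis using palette[of e] by (simp add: new_edge palette_def)
  qed
  ultimately show ?thesis by (auto simp: colourable_def)
qed

section \<open>Reducible configurations\<close>

lemma colourable_add_leaf:
  assumes E: "edge_set E" and k: "\<And>x. card (star E x) \<le> k"
    and old: "colourable K h (avoiding E {u})"
    and u: "card (star E u) = 1" and h: "1 \<le> h" and K: "2 * k + h < K + 2"
  shows "colourable K h E"
proof -
  have "card (nbrs E u) = 1" using u by (simp add: card_nbrs[OF E])
  then obtain p where nu: "nbrs E u = {p}" by (auto simp: card_1_singleton_iff)
  then have up: "{u, p} \<in> E" "p \<noteq> u" "u \<in> nbrs E p"
    using nbrs_irrefl[OF E, of p u] nbrs_sym[of p E u] by (auto simp: nbrs_def)
  let ?E = "avoiding E {u}"
  have E': "edge_set ?E" using E by (rule edge_set_avoiding)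
  have D: "E - ?E = {{u, p}}"
    using star_eq_image[OF E, of u] nu by (auto simp: avoiding_def star_def)
  obtain t c where t: "\<And>e. e \<notin> ?E \<Longrightarrow> t e = u" and tc: "tail_colouring ?E t c" "few_out h ?E t"
      "c ` ?E \<subseteq> {..<K}"
    using colourableE[OF old, of "\<lambda>_. u"] by blast
  have tail: "\<forall>e\<in>?E. t e \<in> e" using tc(1) by (simp add: tail_colouring_def)
  have tup: "t {u, p} = u" using t D by blast
  have deg_p: "card (star ?E p) < card (star E p)"
    using up by (intro card_star_avoiding_less[OF E]) auto
  have "forbidden E {u} t {u, p} \<subseteq> near ?E t p"
    using forbidden_subset_near[OF tail up(1) tup] up(2) nu by simp
  then have "K - (2 * card (star ?E p) + h) \<le> card (palette K E {u} t c {u, p})"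
    by (rule card_palette_near[OF E tail tc(2)])
  moreover have "0 < K - (2 * card (star ?E p) + h)"
    using deg_p k[of p] K by linarith
  ultimately have "palette K E {u} t c {u, p} \<noteq> {}" by auto
  then obtain \<alpha> where \<alpha>: "\<alpha> \<in> palette K E {u} t c {u, p}" by blast
  show ?thesis
  proof (rule colourable_extend[OF tc D, where g = "\<lambda>_. \<alpha>"])
    fix x assume "x \<in> {u}"
    then have x: "x = u" by simp
    have "\<forall>d\<in>{{u, p}}. t d \<in> d" using tup by simp
    then have "\<forall>e\<in>E. t e \<in> e" by (rule tail_in_edge_extend[OF D tail])
    then have "out E t u \<subseteq> star E u" by (rule out_subset_star)
    then have "card (out E t u) \<le> 1"
      using card_mono[OF finite_star[OF E]] u by metis
    moreover have "card (busy_out_nbrs E t u) \<le> card (nbrs E u)"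
      by (intro card_mono finite_nbrs E) (auto simp: busy_out_nbrs_def)
    ultimately show "card (out E t x) \<le> 2 \<and> card (busy_out_nbrs E t x) \<le> h"
      using x h nu by simp
  next
    fix d assume "d \<in> {{u, p}}"
    then have "d = {u, p}" by simp
    then show "t d \<in> d \<and> t d \<in> {u}" "\<alpha> \<in> palette K E {u} t c d"
      using tup \<alpha> by simp_all
  qed simp
qed

text \<open>
  Both edges at \<open>u\<close> get the tail \<open>u\<close>. The edge \<open>up\<close> is coloured first: it avoids the edges near
  \<open>p\<close> and those at \<open>w\<close>, for which \<open>p_room\<close> leaves a colour. The edge \<open>uw\<close> then avoids the edges
  near \<open>w\<close>, those at \<open>p\<close>, and \<open>up\<close>, for which \<open>w_room\<close> leaves a colour. The vertex \<open>u\<close> gets the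
  out-neighbours \<open>p\<close> and \<open>w\<close>; in the case \<open>h = 1\<close>, the degree of \<open>w\<close> prevents \<open>w\<close> from being busy.
\<close>

lemma colourable_add_2_vertex:
  assumes E: "edge_set E" and k: "\<And>x. card (star E x) \<le> k"
    and old: "colourable K h (avoiding E {u})"
    and u: "card (star E u) = 2" "w \<in> nbrs E u"
    and h: "h = 2 \<or> h = 1 \<and> card (star E w) \<le> 2"
    and p_room: "2 * k + h + card (star E w) < K + 3"
    and w_room: "\<And>t. \<forall>e\<in>avoiding E {u}. t e \<in> e \<Longrightarrow> few_out h (avoiding E {u}) t \<Longrightarrow>
      k + card (near (avoiding E {u}) t w) < K"
  shows "colourable K h E"
proof -
  obtain p where nu: "nbrs E u = {p, w}" and pw: "p \<noteq> w" "p \<noteq> u" "w \<noteq> u"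
    using obtain_other_nbr[OF E u] .
  then have up: "{u, p} \<in> E" "p \<noteq> u" "u \<in> nbrs E p" and uw: "{u, w} \<in> E" "w \<noteq> u" "u \<in> nbrs E w"
    using nbrs_sym[of p E u] nbrs_sym[of w E u] by (auto simp: nbrs_def)
  let ?E = "avoiding E {u}"
  have E': "edge_set ?E" using E by (rule edge_set_avoiding)
  have D: "E - ?E = {{u, p}, {u, w}}"
    using star_eq_image[OF E, of u] nu by (auto simp: avoiding_def star_def)
  have D_neq: "{u, p} \<noteq> {u, w}" using pw by (simp add: doubleton_eq_iff)
  obtain t c where t: "\<And>e. e \<notin> ?E \<Longrightarrow> t e = u" and tc: "tail_colouring ?E t c" "few_out h ?E t"
      "c ` ?E \<subseteq> {..<K}"
    using colourableE[OF old, of "\<lambda>_. u"] by blast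
  have tail: "\<forall>e\<in>?E. t e \<in> e" using tc(1) by (simp add: tail_colouring_def)
  have tD: "t {u, p} = u" "t {u, w} = u" using t D by blast+
  have deg: "card (star ?E p) < card (star E p)" "card (star ?E w) < card (star E w)"
    using up uw by (auto intro!: card_star_avoiding_less[OF E])
  let ?P = "near ?E t p \<union> star ?E w" and ?W = "near ?E t w \<union> star ?E p"
  have "card ?P \<le> 2 * card (star ?E p) + h + card (star ?E w)"
    using card_Un_le[of "near ?E t p" "star ?E w"] card_near[OF E' tail tc(2), of p] by linarith
  moreover have "forbidden E {u} t {u, p} \<subseteq> ?P"
    using forbidden_subset_near[OF tail up(1) tD(1)] up(2) nu pw by auto
  moreover have "finite ?P" using finite_near[OF E'] finite_star[OF E'] by blast
  ultimately have "K - (2 * card (star ?E p) + h + card (star ?E w))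
      \<le> card (palette K E {u} t c {u, p})"
    using card_palette[OF E, of "{u}" t "{u, p}" ?P] by simp
  moreover have "0 < K - (2 * card (star ?E p) + h + card (star ?E w))"
    using deg k[of p] p_room by linarith
  ultimately have "palette K E {u} t c {u, p} \<noteq> {}" by auto
  then obtain \<alpha> where \<alpha>: "\<alpha> \<in> palette K E {u} t c {u, p}" by blast
  have "forbidden E {u} t {u, w} \<subseteq> ?W"
    using forbidden_subset_near[OF tail uw(1) tD(2)] uw(2) nu pw by auto
  moreover have "finite ?W" using finite_near[OF E'] finite_star[OF E'] by blast
  ultimately have "K - card ?W \<le> card (palette K E {u} t c {u, w})"
    using card_palette[OF E, of "{u}" t "{u, w}" ?W] by simp
  moreover have "1 < K - card ?W"
    using card_Un_le[of "near ?E t w" "star ?E p"] deg k[of p] w_room[OF tail tc(2)] by linarith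
  ultimately have "card {\<alpha>} < card (palette K E {u} t c {u, w})" by simp
  then have "\<not> palette K E {u} t c {u, w} \<subseteq> {\<alpha>}"
    by (metis card_mono finite.emptyI finite_insert not_le)
  then obtain \<beta> where \<beta>: "\<beta> \<in> palette K E {u} t c {u, w}" "\<beta> \<noteq> \<alpha>" by blast
  show ?thesis
  proof (rule colourable_extend[OF tc D, where g = "\<lambda>e. if e = {u, p} then \<alpha> else \<beta>"])
    fix x assume "x \<in> {u}"
    then have x: "x = u" by simp
    have "\<forall>d\<in>{{u, p}, {u, w}}. t d \<in> d" using tD by simp
    then have "\<forall>e\<in>E. t e \<in> e" by (rule tail_in_edge_extend[OF D tail])
    then have "out E t u \<subseteq> star E u" by (rule out_subset_star)
    then have "card (out E t u) \<le> 2"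
      using card_mono[OF finite_star[OF E]] u by metis
    moreover have "card (busy_out_nbrs E t u) \<le> h"
    proof (cases "h = 2")
      case True
      have "card (busy_out_nbrs E t u) \<le> card (nbrs E u)"
        by (intro card_mono finite_nbrs E) (auto simp: busy_out_nbrs_def)
      then show ?thesis using True nu pw by simp
    next
      case False
      have "\<forall>d\<in>E - ?E. t d \<in> {u}" unfolding D using tD by simp
      then have "out E t w = out ?E t w" using uw(2) by (intro out_avoiding) simp_all
      then have "out E t w \<subseteq> star ?E w" using out_subset_star[OF tail] by simp
      then have "card (out E t w) \<le> card (star ?E w)"
        by (rule card_mono[OF finite_star[OF E']])
      then have "card (out E t w) \<le> 1" using False h deg(2) by linarith
      then have "busy_out_nbrs E t u \<subseteq> {p}" using nu by (auto simp: busy_out_nbrs_def)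
      then have "card (busy_out_nbrs E t u) \<le> card {p}" by (intro card_mono) auto
      then show ?thesis using False h by simp
    qed
    ultimately show "card (out E t x) \<le> 2 \<and> card (busy_out_nbrs E t x) \<le> h"
      using x by simp
  next
    fix d assume "d \<in> {{u, p}, {u, w}}"
    then consider "d = {u, p}" | "d = {u, w}" by blast
    then show "t d \<in> d \<and> t d \<in> {u}"
      "(if d = {u, p} then \<alpha> else \<beta>) \<in> palette K E {u} t c d"
      using tD \<alpha> \<beta> D_neq by (cases; simp)+
  next
    fix d d' assume "d \<in> {{u, p}, {u, w}}" "d' \<in> {{u, p}, {u, w}}" "d \<noteq> d'"
    then show "(if d = {u, p} then \<alpha> else \<beta>) \<noteq> (if d' = {u, p} then \<alpha> else \<beta>)"
      using \<beta>(2) D_neq by auto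
  qed
qed


lemma exists_not_in_list:
  assumes "length xs < card A"
  shows "\<exists>a\<in>A. a \<notin> set xs"
proof (rule ccontr)
  assume "\<not> (\<exists>a\<in>A. a \<notin> set xs)"
  then have "A \<subseteq> set xs" by blast
  then have "card A \<le> card (set xs)" by (simp add: card_mono)
  then show False using assms card_length[of xs] by linarith
qed

text \<open>
  The colour \<open>a\<close> is chosen outside \<open>U\<close>, so that only \<open>w\<close> and \<open>b\<close> can block colours of \<open>U\<close>. Only
  \<open>a\<close> and \<open>b\<close> can block colours of \<open>V\<close>.
\<close>

lemma choose_five_colours_shared:
  assumes "finite U" "card U = 3" "card V = 3" "4 \<le> card A" "4 \<le> card B"
    and "w \<in> U" "w \<notin> V"
  shows "\<exists>a\<in>A. \<exists>b\<in>B. \<exists>u\<in>U. \<exists>v\<in>V. distinct [w, a, b] \<and> u \<notin> {w, a, b} \<and> v \<notin> {w, a, b}"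
proof -
  have "\<not> A \<subseteq> U"
    using assms card_mono[of U A] by linarith
  then obtain a where a: "a \<in> A" "a \<notin> U" by blast
  obtain b where b: "b \<in> B" "b \<notin> set [w, a]"
    using exists_not_in_list[of "[w, a]" B] assms by auto
  obtain u where u: "u \<in> U" "u \<notin> set [w, b]"
    using exists_not_in_list[of "[w, b]" U] assms by auto
  obtain v where v: "v \<in> V" "v \<notin> set [a, b]"
    using exists_not_in_list[of "[a, b]" V] assms by auto
  show ?thesis
    using a b u v assms(6,7) by (intro bexI[of _ a] bexI[of _ b] bexI[of _ u] bexI[of _ v]) auto
qed

text \<open>
  This is list colouring of the complete graph on five vertices, without the edge between \<open>u\<close> and \<open>v\<close>
  if \<open>P\<close> holds. If \<open>u\<close> and \<open>v\<close> can share a colour, the remaining triangle has lists of sizes at least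
  2, 3 and 3. If they cannot because their lists are disjoint, a colour \<open>w\<close> lies in at most one of the two
  lists, and only that list needs care. Without \<open>P\<close>, the lists of \<open>u\<close> and \<open>v\<close> are long enough to colour
  these two vertices last.
\<close>

lemma choose_five_colours:
  assumes "3 \<le> card W" "3 \<le> card U" "3 \<le> card V" "4 \<le> card A" "4 \<le> card B"
    and separate: "\<not> P \<Longrightarrow> 5 \<le> card U \<and> 5 \<le> card V"
  shows "\<exists>w\<in>W. \<exists>a\<in>A. \<exists>b\<in>B. \<exists>u\<in>U. \<exists>v\<in>V.
    distinct [w, a, b] \<and> u \<notin> {w, a, b} \<and> v \<notin> {w, a, b} \<and> (P \<or> u \<noteq> v)"
proof (cases P)
  case False
  obtain w where w: "w \<in> W" using exists_not_in_list[of "[]" W] assms by auto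
  obtain a where a: "a \<in> A" "a \<notin> set [w]" using exists_not_in_list[of "[w]" A] assms by auto
  obtain b where b: "b \<in> B" "b \<notin> set [w, a]"
    using exists_not_in_list[of "[w, a]" B] assms by auto
  obtain u where u: "u \<in> U" "u \<notin> set [w, a, b]"
    using exists_not_in_list[of "[w, a, b]" U] separate[OF False] by auto
  obtain v where v: "v \<in> V" "v \<notin> set [w, a, b, u]"
    using exists_not_in_list[of "[w, a, b, u]" V] separate[OF False] by auto
  show ?thesis
    using w a b u v
    by (intro bexI[of _ w] bexI[of _ a] bexI[of _ b] bexI[of _ u] bexI[of _ v]) auto
next
  case True
  show ?thesis
  proof (cases "U \<inter> V = {}")
    case False
    then obtain x where x: "x \<in> U" "x \<in> V" by blast
    obtain w where w: "w \<in> W" "w \<notin> set [x]" using exists_not_in_list[of "[x]" W] assms by auto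
    obtain a where a: "a \<in> A" "a \<notin> set [x, w]"
      using exists_not_in_list[of "[x, w]" A] assms by auto
    obtain b where b: "b \<in> B" "b \<notin> set [x, w, a]"
      using exists_not_in_list[of "[x, w, a]" B] assms by auto
    show ?thesis
      using w a b x True
      by (intro bexI[of _ w] bexI[of _ a] bexI[of _ b] bexI[of _ x]) auto
  next
    case disjoint: True
    obtain U' where U': "U' \<subseteq> U" "card U' = 3" "finite U'"
      using obtain_subset_with_card_n[OF assms(2)] by metis
    obtain V' where V': "V' \<subseteq> V" "card V' = 3" "finite V'"
      using obtain_subset_with_card_n[OF assms(3)] by metis
    obtain w where w: "w \<in> W" using exists_not_in_list[of "[]" W] assms by auto
    consider "w \<in> U'" "w \<notin> V'" | "w \<in> V'" "w \<notin> U'" | "w \<notin> U'" "w \<notin> V'"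
      using disjoint U' V' by blast
    then have "\<exists>a\<in>A. \<exists>b\<in>B. \<exists>u\<in>U'. \<exists>v\<in>V'.
      distinct [w, a, b] \<and> u \<notin> {w, a, b} \<and> v \<notin> {w, a, b}"
    proof cases
      case 1
      then show ?thesis using choose_five_colours_shared[of U' V' A B w] U' V' assms by blast
    next
      case 2
      then show ?thesis using choose_five_colours_shared[of V' U' A B w] U' V' assms by blast
    next
      case 3
      obtain a where a: "a \<in> A" "a \<notin> set [w]" using exists_not_in_list[of "[w]" A] assms by auto
      obtain b where b: "b \<in> B" "b \<notin> set [w, a]"
        using exists_not_in_list[of "[w, a]" B] assms by auto
      obtain u where u: "u \<in> U'" "u \<notin> set [a, b]"
        using exists_not_in_list[of "[a, b]" U'] U' by auto
      obtain v where v: "v \<in> V'" "v \<notin> set [a, b]"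
        using exists_not_in_list[of "[a, b]" V'] V' by auto
      show ?thesis
        using a b u v 3 by (intro bexI[of _ a] bexI[of _ b] bexI[of _ u] bexI[of _ v]) auto
    qed
    then show ?thesis using w U'(1) V'(1) True by blast
  qed
qed

text \<open>
  The five edges \<open>ua\<close>, \<open>vb\<close>, \<open>wx\<close>, \<open>uw\<close>, \<open>vw\<close> are new, where \<open>a\<close>, \<open>b\<close>, \<open>x\<close> denote the old neighbours of
  \<open>u\<close>, \<open>v\<close>, \<open>w\<close>. The edges \<open>uw\<close> and \<open>vw\<close> leave \<open>u\<close> and \<open>v\<close>, so that \<open>w\<close> has out-degree 1 and is
  not busy. The first three edges keep at least 3 colours each. The last two keep at least
  \<open>k + 1\<close>, since only the edges at \<open>a\<close> (or \<open>b\<close>) and the at most two arcs leaving \<open>x\<close> matter. The only pair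
  without conflict is \<open>ua\<close>, \<open>vb\<close> for \<open>a \<noteq> b\<close>. If \<open>a = b\<close>, then two edges at \<open>a\<close> are
  new and the old ones forbid fewer colours.
  
  A greedy choice of colours may fail for \<open>k = 3\<close>: each edge is in conflict with up to four of the others,
  and the lists have sizes 3 and 4 only. This is why \<open>choose_five_colours\<close> is used.
\<close>

lemma colourable_add_3_vertex:
  assumes E: "edge_set E" and k: "\<And>x. card (star E x) \<le> k"
    and w: "card (star E w) = 3"
    and u: "u \<in> nbrs E w" "card (star E u) = 2" and v: "v \<in> nbrs E w" "card (star E v) = 2"
    and uv: "u \<noteq> v" "u \<notin> nbrs E v"
    and old: "colourable (2 * k + 2) 1 (avoiding E {u, v, w})"
  shows "colourable (2 * k + 2) 1 E"
proof -
  let ?X = "{u, v, w}" and ?K = "2 * k + 2"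
  let ?E = "avoiding E ?X"
  have E': "edge_set ?E" using E by (rule edge_set_avoiding)
  have wu: "w \<in> nbrs E u" and wv: "w \<in> nbrs E v"
    using u v nbrs_sym[of _ E w] by simp_all
  obtain a where nu: "nbrs E u = {a, w}" and a: "a \<noteq> w" "a \<noteq> u" "w \<noteq> u"
    using obtain_other_nbr[OF E u(2) wu] .
  obtain b where nv: "nbrs E v = {b, w}" and b: "b \<noteq> w" "b \<noteq> v" "w \<noteq> v"
    using obtain_other_nbr[OF E v(2) wv] .
  have "card (nbrs E w - {u, v}) = 1"
    using w u(1) v(1) uv(1) by (simp add: card_nbrs[OF E] finite_nbrs[OF E] card_Diff_subset)
  then obtain x where x_eq: "nbrs E w - {u, v} = {x}" by (auto simp: card_1_singleton_iff)
  then have nw: "nbrs E w = {u, v, x}" using u(1) v(1) by blast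
  have x: "x \<noteq> u" "x \<noteq> v" "x \<noteq> w"
    using x_eq nbrs_irrefl[OF E, of x w] by blast+
  have av: "a \<noteq> v" and bu: "b \<noteq> u"
    using uv(2) nu nv nbrs_sym[of u E v] by blast+
  let ?D = "{{u, a}, {v, b}, {w, x}, {u, w}, {v, w}}"
  have D: "E - ?E = ?D"
  proof -
    have "E - ?E = star E u \<union> star E v \<union> star E w" by (auto simp: avoiding_def star_def)
    also have "\<dots> = ?D" by (auto simp: star_eq_image[OF E] nu nv nw)
    finally show ?thesis .
  qed
  have DE: "{u, a} \<in> E" "{v, b} \<in> E" "{w, x} \<in> E" "{u, w} \<in> E" "{v, w} \<in> E"
    using D by blast+
  define t0 where "t0 e = (if u \<in> e then u else if v \<in> e then v else w)" for e
  obtain t c where t: "\<And>e. e \<notin> ?E \<Longrightarrow> t e = t0 e" and tc: "tail_colouring ?E t c" "few_out 1 ?E t"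
      "c ` ?E \<subseteq> {..<?K}"
    using colourableE[OF old, of t0] by blast
  have tail: "\<forall>e\<in>?E. t e \<in> e" using tc(1) by (simp add: tail_colouring_def)
  have "t d = t0 d" if "d \<in> ?D" for d using t D that by blast
  then have tD: "t {u, a} = u" "t {v, b} = v" "t {w, x} = w" "t {u, w} = u" "t {v, w} = v"
    using a b x av bu uv(1) by (simp_all add: t0_def)
  have tailD: "\<forall>d\<in>?D. t d \<in> d" using tD by simp
  then have tailE: "\<forall>e\<in>E. t e \<in> e" by (rule tail_in_edge_extend[OF D tail])

  have deg_a: "card (star ?E a) < card (star E a)" and deg_b: "card (star ?E b) < card (star E b)"
    and deg_x: "card (star ?E x) < card (star E x)"
    using card_star_avoiding_less[OF E, of u a ?X] card_star_avoiding_less[OF E, of v b ?X]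
      card_star_avoiding_less[OF E, of w x ?X] nu nv nw nbrs_sym[of _ E] by blast+

  let ?L = "palette ?K E ?X t c"
  have star_X: "star ?E y = {}" if "y \<in> ?X" for y using that by (rule star_avoiding_eq_empty)
  have out_X: "out ?E t y = {}" if "y \<in> ?X" for y
    using out_subset_star[OF tail, of y] star_X[OF that] by blast

  have "forbidden E ?X t {u, a} \<subseteq> near ?E t a"
    using forbidden_subset_near[OF tail DE(1) tD(1)] a av nu star_X by auto
  then have L_ua: "?K - (2 * card (star ?E a) + 1) \<le> card (?L {u, a})"
    by (rule card_palette_near[OF E tail tc(2)])
  have "forbidden E ?X t {v, b} \<subseteq> near ?E t b"
    using forbidden_subset_near[OF tail DE(2) tD(2)] b bu nv star_X by auto
  then have L_vb: "?K - (2 * card (star ?E b) + 1) \<le> card (?L {v, b})"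
    by (rule card_palette_near[OF E tail tc(2)])
  have "forbidden E ?X t {w, x} \<subseteq> near ?E t x"
    using forbidden_subset_near[OF tail DE(3) tD(3)] x nw star_X by auto
  then have L_wx: "?K - (2 * card (star ?E x) + 1) \<le> card (?L {w, x})"
    by (rule card_palette_near[OF E tail tc(2)])
  have fin: "finite (star ?E y \<union> out ?E t x)" for y
    by (simp add: finite_star[OF E'] finite_out[OF E'])
  have out_x: "card (out ?E t x) \<le> 2" using tc(2) by (simp add: few_out_def)
  have "forbidden E ?X t {u, w} \<subseteq> star ?E a \<union> out ?E t x"
    using forbidden_subset[OF tail DE(4) tD(4)] nu nw star_X out_X by auto
  moreover have "card (star ?E a \<union> out ?E t x) \<le> card (star ?E a) + 2"
    using card_Un_le[of "star ?E a" "out ?E t x"] out_x by linarith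
  ultimately have L_uw: "?K - (card (star ?E a) + 2) \<le> card (?L {u, w})"
    by (rule card_palette[OF E _ fin])
  have "forbidden E ?X t {v, w} \<subseteq> star ?E b \<union> out ?E t x"
    using forbidden_subset[OF tail DE(5) tD(5)] nv nw star_X out_X by auto
  moreover have "card (star ?E b \<union> out ?E t x) \<le> card (star ?E b) + 2"
    using card_Un_le[of "star ?E b" "out ?E t x"] out_x by linarith
  ultimately have L_vw: "?K - (card (star ?E b) + 2) \<le> card (?L {v, w})"
    by (rule card_palette[OF E _ fin])

  have k3: "3 \<le> k" using k[of w] w by simp
  have "\<exists>\<omega>\<in>?L {w, x}. \<exists>\<alpha>\<in>?L {u, w}. \<exists>\<beta>\<in>?L {v, w}. \<exists>\<mu>\<in>?L {u, a}. \<exists>\<nu>\<in>?L {v, b}.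
    distinct [\<omega>, \<alpha>, \<beta>] \<and> \<mu> \<notin> {\<omega>, \<alpha>, \<beta>} \<and> \<nu> \<notin> {\<omega>, \<alpha>, \<beta>} \<and> (a \<noteq> b \<or> \<mu> \<noteq> \<nu>)"
  proof (rule choose_five_colours)
    show "3 \<le> card (?L {w, x})" using L_wx deg_x k[of x] by linarith
    show "3 \<le> card (?L {u, a})" using L_ua deg_a k[of a] by linarith
    show "3 \<le> card (?L {v, b})" using L_vb deg_b k[of b] by linarith
    show "4 \<le> card (?L {u, w})" using L_uw deg_a k[of a] k3 by linarith
    show "4 \<le> card (?L {v, w})" using L_vw deg_b k[of b] k3 by linarith
    assume "\<not> a \<noteq> b"
    then have ab: "b = a" by simp
    have "card (star ?E a) + 2 \<le> card (star E a)"
      using card_star_avoiding_add_2[OF E, of u a ?X v] nu nv uv(1) ab nbrs_sym[of _ E] by blast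
    then show "5 \<le> card (?L {u, a}) \<and> 5 \<le> card (?L {v, b})"
      using L_ua L_vb k[of a] unfolding ab by linarith
  qed
  then obtain \<omega> \<alpha> \<beta> \<mu> \<nu> where
    in_L: "\<omega> \<in> ?L {w, x}" "\<alpha> \<in> ?L {u, w}" "\<beta> \<in> ?L {v, w}" "\<mu> \<in> ?L {u, a}" "\<nu> \<in> ?L {v, b}"
    and neq: "distinct [\<omega>, \<alpha>, \<beta>]" "\<mu> \<notin> {\<omega>, \<alpha>, \<beta>}" "\<nu> \<notin> {\<omega>, \<alpha>, \<beta>}" "a \<noteq> b \<or> \<mu> \<noteq> \<nu>"
    by blast
  define g where "g e = (if e = {u, a} then \<mu> else if e = {v, b} then \<nu>
    else if e = {w, x} then \<omega> else if e = {u, w} then \<alpha> else \<beta>)" for e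
  have g: "g {u, a} = \<mu>" "g {v, b} = \<nu>" "g {w, x} = \<omega>" "g {u, w} = \<alpha>" "g {v, w} = \<beta>"
    using a b x av bu uv(1) by (auto simp: g_def doubleton_eq_iff)
  have far: "\<not> conflict E t {u, a} {v, b}" "\<not> conflict E t {v, b} {u, a}" if "a \<noteq> b"
    using that a b av bu uv(1) tD nu nv by (auto simp: conflict_def)
  show ?thesis
  proof (rule colourable_extend[OF tc D, where g = g])
    fix d assume "d \<in> ?D"
    then consider "d = {u, a}" | "d = {v, b}" | "d = {w, x}" | "d = {u, w}" | "d = {v, w}" by blast
    then show "t d \<in> d \<and> t d \<in> ?X" "g d \<in> ?L d"
      using tD g in_L by (cases; simp)+
  next
    fix d d' assume d: "d \<in> ?D" and d': "d' \<in> ?D" and "d \<noteq> d'" "conflict E t d d'"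
    from d consider "d = {u, a}" | "d = {v, b}" | "d = {w, x}" | "d = {u, w}" | "d = {v, w}" by blast
    then show "g d \<noteq> g d'"
    proof cases
      case 1
      then consider "d' = {v, b}" | "d' = {w, x}" | "d' = {u, w}" | "d' = {v, w}"
        using d' \<open>d \<noteq> d'\<close> by blast
      then show ?thesis using 1 g neq far \<open>conflict E t d d'\<close> by cases auto
    next
      case 2
      then consider "d' = {u, a}" | "d' = {w, x}" | "d' = {u, w}" | "d' = {v, w}"
        using d' \<open>d \<noteq> d'\<close> by blast
      then show ?thesis using 2 g neq far \<open>conflict E t d d'\<close> by cases auto
    next
      case 3
      then consider "d' = {u, a}" | "d' = {v, b}" | "d' = {u, w}" | "d' = {v, w}"
        using d' \<open>d \<noteq> d'\<close> by blast
      then show ?thesis using 3 g neq by cases auto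
    next
      case 4
      then consider "d' = {u, a}" | "d' = {v, b}" | "d' = {w, x}" | "d' = {v, w}"
        using d' \<open>d \<noteq> d'\<close> by blast
      then show ?thesis using 4 g neq by cases auto
    next
      case 5
      then consider "d' = {u, a}" | "d' = {v, b}" | "d' = {w, x}" | "d' = {u, w}"
        using d' \<open>d \<noteq> d'\<close> by blast
      then show ?thesis using 5 g neq by cases auto
    qed
  next
    fix y assume y: "y \<in> ?X"
    have "out E t y \<subseteq> star E y" using tailE by (rule out_subset_star)
    then have out_le: "card (out E t y) \<le> card (star E y)" by (rule card_mono[OF finite_star[OF E]])
    have out_wx: "\<forall>d\<in>?D. t d = w \<longrightarrow> d = {w, x}" using tD a(3) b(3) by simp
    have "out E t w \<subseteq> {{w, x}}"
    proof
      fix e assume "e \<in> out E t w"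
      then have e: "e \<in> E" "t e = w" by (auto simp: out_def)
      then have "e \<notin> ?E" using tail by (auto simp: avoiding_def)
      then have "e \<in> E - ?E" using e(1) by simp
      then have "e \<in> ?D" unfolding D .
      with out_wx have "t e = w \<longrightarrow> e = {w, x}" by (rule bspec)
      then show "e \<in> {{w, x}}" using e(2) by simp
    qed
    then have out_w: "card (out E t w) \<le> 1"
      using card_mono[of "{{w, x}}" "out E t w"] by simp
    have busy_le: "card (busy_out_nbrs E t y) \<le> 1" if "busy_out_nbrs E t y \<subseteq> {z}" for z
      using card_mono[OF _ that] by simp
    from y consider "y = u" | "y = v" | "y = w" by blast
    then show "card (out E t y) \<le> 2 \<and> card (busy_out_nbrs E t y) \<le> 1"
    proof cases
      case 1
      have "busy_out_nbrs E t u \<subseteq> {a}" using nu out_w by (auto simp: busy_out_nbrs_def)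
      then show ?thesis using 1 out_le u(2) busy_le[of a] by simp
    next
      case 2
      have "busy_out_nbrs E t v \<subseteq> {b}" using nv out_w by (auto simp: busy_out_nbrs_def)
      then show ?thesis using 2 out_le v(2) busy_le[of b] by simp
    next
      case 3
      have "t {w, u} \<noteq> w" "t {w, v} \<noteq> w"
        using tD a(3) b(3) by (simp_all add: insert_commute)
      then have "busy_out_nbrs E t w \<subseteq> {x}" using nw by (auto simp: busy_out_nbrs_def)
      then show ?thesis using 3 out_w busy_le[of x] by simp
    qed
  qed
qed


section \<open>Discharging\<close>

lemma sum_card_star:
  assumes "edge_set E"
  shows "(\<Sum>x\<in>\<Union>E. card (star E x)) = 2 * card E"
proof -
  have "card {x \<in> \<Union>E. x \<in> e} = 2" if "e \<in> E" for e
  proof -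
    have "{x \<in> \<Union>E. x \<in> e} = e" using that by blast
    then show ?thesis using that assms by (simp add: edge_set_def)
  qed
  moreover have "finite E" "finite (\<Union>E)"
    using assms by (auto simp: edge_set_def card_ge_0_finite)
  ultimately show ?thesis
    unfolding star_def by (intro sum_multicount) auto
qed

definition nbrs2 :: "'a set set \<Rightarrow> 'a \<Rightarrow> 'a set" where
  "nbrs2 E x = {y \<in> nbrs E x. card (star E y) = 2}"

lemma sum_card_nbrs2:
  assumes E: "edge_set E"
  shows "(\<Sum>x\<in>\<Union>E. card (nbrs2 E x)) = 2 * card {y \<in> \<Union>E. card (star E y) = 2}"
proof -
  let ?T = "{y \<in> \<Union>E. card (star E y) = 2}"
  have fin: "finite (\<Union>E)"
    using E by (auto simp: edge_set_def card_ge_0_finite)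
  have "card {x \<in> \<Union>E. y \<in> nbrs E x} = 2" if y: "y \<in> ?T" for y
  proof -
    have "{x \<in> \<Union>E. y \<in> nbrs E x} = nbrs E y" by (auto simp: nbrs_def insert_commute)
    then show ?thesis using y by (simp add: card_nbrs[OF E])
  qed
  moreover have "finite ?T" by (rule rev_finite_subset[OF fin]) blast
  ultimately have "(\<Sum>x\<in>\<Union>E. card {y \<in> ?T. y \<in> nbrs E x}) = 2 * card ?T"
    using fin by (intro sum_multicount) blast+
  moreover have "{y \<in> ?T. y \<in> nbrs E x} = nbrs2 E x" for x
    by (auto simp: nbrs2_def nbrs_def)
  ultimately show ?thesis by simp
qed

text \<open>
  A vertex \<open>x\<close> has the charge \<open>a deg x - b\<close>, and the charges add up to \<open>2 a |E| - b |V| < 0\<close>. Let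
  each vertex of degree 2 receive \<open>r\<close> from each of its two neighbours. This does not change the total, so the
  new charge is negative at some vertex. The subtracted terms are moved to the other side to
  stay within the natural numbers.
\<close>

lemma exists_undercharged:
  assumes E: "edge_set E" and sparse: "2 * a * card E < b * card (\<Union>E)"
  shows "\<exists>x\<in>\<Union>E.
    a * card (star E x) + (if card (star E x) = 2 then 2 * r else 0) < b + r * card (nbrs2 E x)"
proof (rule ccontr)
  assume "\<not> ?thesis"
  then have charged: "b + r * card (nbrs2 E x) \<le>
      a * card (star E x) + (if card (star E x) = 2 then 2 * r else 0)" if "x \<in> \<Union>E" for x
    using that by (meson not_le)
  let ?T = "{y \<in> \<Union>E. card (star E y) = 2}"
  have fin: "finite (\<Union>E)"
    using E by (auto simp: edge_set_def card_ge_0_finite)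
  have total: "(\<Sum>x\<in>\<Union>E. b + r * card (nbrs2 E x)) \<le>
      (\<Sum>x\<in>\<Union>E. a * card (star E x) + (if card (star E x) = 2 then 2 * r else 0))"
    by (rule sum_mono[OF charged])
  have "(\<Sum>x\<in>\<Union>E. b + r * card (nbrs2 E x)) = b * card (\<Union>E) + r * (2 * card ?T)"
    by (simp only: sum.distrib sum_distrib_left[symmetric] sum_card_nbrs2[OF E]) simp
  moreover have "(\<Sum>x\<in>\<Union>E. a * card (star E x) + (if card (star E x) = 2 then 2 * r else 0))
      = a * (2 * card E) + card ?T * (2 * r)"
  proof -
    have "(\<Sum>x\<in>\<Union>E. if card (star E x) = 2 then 2 * r else 0) = card ?T * (2 * r)"
      using fin by (simp add: sum.If_cases Int_def)
    then show ?thesis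
      by (simp only: sum.distrib sum_distrib_left[symmetric] sum_card_star[OF E])
  qed
  ultimately have "b * card (\<Union>E) + r * (2 * card ?T) \<le> a * (2 * card E) + card ?T * (2 * r)"
    using total by simp
  then show False using sparse by (simp add: algebra_simps)
qed

section \<open>Colouring sparse graphs\<close>

text \<open>
  The average degree of every non-empty graph formed by edges of \<open>E\<close> is less than \<open>2 n / m\<close>. It is
  enough to consider the subgraphs induced by sets \<open>U\<close> of vertices.
\<close>

definition sparse :: "nat \<Rightarrow> nat \<Rightarrow> 'a set set \<Rightarrow> bool" where
  "sparse m n E \<longleftrightarrow>
     (\<forall>U. finite U \<and> U \<noteq> {} \<longrightarrow> m * card {e \<in> E. e \<subseteq> U} < n * card U)"

lemma sparse_mono:
  assumes "sparse m n E" "F \<subseteq> E" "finite E"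
  shows "sparse m n F"
  unfolding sparse_def
proof (intro allI impI)
  fix U :: "'a set" assume "finite U \<and> U \<noteq> {}"
  then have "m * card {e \<in> E. e \<subseteq> U} < n * card U" using assms(1) by (simp add: sparse_def)
  moreover have "card {e \<in> F. e \<subseteq> U} \<le> card {e \<in> E. e \<subseteq> U}"
    using assms by (intro card_mono) auto
  ultimately show "m * card {e \<in> F. e \<subseteq> U} < n * card U"
    by (meson le_less_trans mult_le_mono2)
qed

lemma sparse_induct [consumes 3, case_names empty step]:
  assumes "edge_set E" "sparse m n E" "\<And>x. card (star E x) \<le> k"
    and empty: "P {}"
    and step: "\<And>E. edge_set E \<Longrightarrow> m * card E < n * card (\<Union>E) \<Longrightarrow> (\<And>x. card (star E x) \<le> k) \<Longrightarrow>
      (\<And>X x. x \<in> X \<Longrightarrow> x \<in> \<Union>E \<Longrightarrow> P (avoiding E X)) \<Longrightarrow> P E"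
  shows "P E"
  using assms(1-3)
proof (induction "card E" arbitrary: E rule: less_induct)
  case less
  have finE: "finite E" using less.prems(1) by (simp add: edge_set_def)
  show ?case
  proof (cases "E = {}")
    case True
    then show ?thesis using empty by simp
  next
    case False
    show ?thesis
    proof (rule step)
      have "\<Union>E \<noteq> {}" "finite (\<Union>E)"
        using less.prems(1) False by (fastforce simp: edge_set_def card_ge_0_finite)+
      moreover have "{e \<in> E. e \<subseteq> \<Union>E} = E" by blast
      ultimately show "m * card E < n * card (\<Union>E)"
        using less.prems(2) unfolding sparse_def by metis
    next
      fix X x assume x: "x \<in> X" "x \<in> \<Union>E"
      have sub: "avoiding E X \<subseteq> E" by (auto simp: avoiding_def)
      have "avoiding E X \<noteq> E" using x by (auto simp: avoiding_def)
      then have "card (avoiding E X) < card E"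
        using sub finE by (intro psubset_card_mono) auto
      moreover have "card (star (avoiding E X) y) \<le> k" for y
      proof -
        have "card (star (avoiding E X) y) \<le> card (star E y)"
          using sub finE by (intro card_mono) (auto simp: star_def)
        then show ?thesis using less.prems(3)[of y] by linarith
      qed
      ultimately show "P (avoiding E X)"
        using less.hyps less.prems(1,2) edge_set_avoiding sparse_mono[OF _ sub finE] by blast
    qed (use less.prems in auto)
  qed
qed

lemma colourable_empty: "colourable K h {}"
  by (simp add: colourable_def tail_colouring_def few_out_def out_def busy_out_nbrs_def nbrs_def)

lemma card_nbrs2_le: "edge_set E \<Longrightarrow> card (nbrs2 E x) \<le> card (star E x)"
  using card_mono[OF finite_nbrs, of E "nbrs2 E x" x] by (auto simp: nbrs2_def card_nbrs)

lemma nbrs2_eq_nbrs: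
  assumes "edge_set E" "card (nbrs2 E x) = card (star E x)"
  shows "nbrs2 E x = nbrs E x"
  using assms by (intro card_subset_eq) (auto simp: nbrs2_def finite_nbrs card_nbrs)

lemma card_star_pos: "edge_set E \<Longrightarrow> x \<in> \<Union>E \<Longrightarrow> 0 < card (star E x)"
  using finite_star[of E x] by (auto simp: card_gt_0_iff star_def)

text \<open>
  The charges are multiplied by 5, so a vertex of degree 2 receives 2 from each neighbour. A vertex
  of degree \<open>d \<ge> 5\<close> can afford this, as \<open>5 d - 14 \<ge> 2 d\<close>. A vertex of degree 4 has charge 6 and can serve
  three neighbours of degree 2, a vertex of degree 3 has charge 1 and can serve none.
\<close>

lemma colourable_if_sparse_5_7:
  assumes "edge_set E" "sparse 5 7 E" "\<And>x. card (star E x) \<le> k"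
  shows "colourable (2 * k + 4) 2 E"
  using assms
proof (induction rule: sparse_induct)
  case empty
  show ?case by (rule colourable_empty)
next
  case (step E)
  note E = step(1) and k = step(3) and IH = step(4)
  have in_Union: "x \<in> \<Union>E" if "y \<in> nbrs E x" for x y using that by (auto simp: nbrs_def)
  have remove_2_vertex: "colourable (2 * k + 4) 2 E"
    if u: "card (star E u) = 2" "w \<in> nbrs E u"
      and w: "card (star E w) \<le> 3 \<or> card (star E w) = 4 \<and> nbrs2 E w = nbrs E w" for u w
  proof (rule colourable_add_2_vertex[OF E k _ u])
    let ?E = "avoiding E {u}"
    have E': "edge_set ?E" using E by (rule edge_set_avoiding)
    show "colourable (2 * k + 4) 2 ?E" using IH[of u "{u}"] in_Union[OF u(2)] by simp
    show "2 * k + 2 + card (star E w) < 2 * k + 4 + 3" using w by auto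
    have uw: "u \<in> nbrs E w" using u(2) nbrs_sym[of u E w] by simp
    have deg_w: "card (star ?E w) < card (star E w)"
      using uw by (intro card_star_avoiding_less[OF E]) auto
    fix t assume t: "\<forall>e\<in>?E. t e \<in> e" "few_out 2 ?E t"
    show "k + card (near ?E t w) < 2 * k + 4"
    proof (cases "card (star E w) \<le> 3")
      case True
      then show ?thesis using card_near[OF E' t, of w] deg_w k[of w] by linarith
    next
      case False
      have "card (star ?E y) \<le> 2" if "y \<in> nbrs ?E w" for y
      proof -
        have "y \<in> nbrs E w" using that by (auto simp: nbrs_avoiding split: if_splits)
        then have "card (star E y) = 2" using w False by (auto simp: nbrs2_def)
        moreover have "card (star ?E y) \<le> card (star E y)"
          by (intro card_mono finite_star[OF E]) (auto simp: star_def avoiding_def)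
        ultimately show ?thesis by simp
      qed
      then have "card (near ?E t w) \<le> 2 * card (star ?E w)"
        by (rule card_near_of_thin_nbrs[OF E' t(1)])
      then show ?thesis using deg_w k[of w] w False by linarith
    qed
  qed simp
  obtain x where x: "x \<in> \<Union>E"
    "5 * card (star E x) + (if card (star E x) = 2 then 2 * 2 else 0) < 14 + 2 * card (nbrs2 E x)"
    using exists_undercharged[OF E, of 5 14 2] step(2) by auto
  have le: "card (nbrs2 E x) \<le> card (star E x)" using E by (rule card_nbrs2_le)
  have pos: "0 < card (star E x)" using E x(1) by (rule card_star_pos)
  consider "card (star E x) = 1" | "card (star E x) = 2" "0 < card (nbrs2 E x)"
    | "card (star E x) = 3" "0 < card (nbrs2 E x)"
    | "card (star E x) = 4" "card (nbrs2 E x) = 4"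
    using x(2) le pos by (cases "card (star E x) = 2") (simp, linarith)
  then show ?case
  proof cases
    case 1
    then show ?thesis using colourable_add_leaf[OF E k _ 1] IH[of x "{x}"] x(1) by simp
  next
    case 2
    then obtain w where "w \<in> nbrs2 E x" by (metis card.empty all_not_in_conv less_irrefl)
    then show ?thesis using 2 remove_2_vertex[of x w] by (simp add: nbrs2_def)
  next
    case 3
    then obtain u where "u \<in> nbrs2 E x" by (metis card.empty all_not_in_conv less_irrefl)
    then show ?thesis using 3 remove_2_vertex[of u x] nbrs_sym[of u E x] by (simp add: nbrs2_def)
  next
    case 4
    then have all: "nbrs2 E x = nbrs E x" by (intro nbrs2_eq_nbrs[OF E]) simp
    obtain u where "u \<in> nbrs2 E x" using 4 by (metis card.empty all_not_in_conv zero_neq_numeral)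
    then show ?thesis using 4 all remove_2_vertex[of u x] nbrs_sym[of u E x] by (simp add: nbrs2_def)
  qed
qed

text \<open>
  The charges are multiplied by 3, so a vertex of degree 2 receives 1 from each neighbour. A vertex
  of degree \<open>d \<ge> 4\<close> can afford this, as \<open>3 d - 8 \<ge> d\<close>, and a vertex of degree 3 has charge 1 and can serve
  one neighbour of degree 2.
\<close>

lemma colourable_if_sparse_3_4:
  assumes "edge_set E" "sparse 3 4 E" "\<And>x. card (star E x) \<le> k"
  shows "colourable (2 * k + 2) 1 E"
  using assms
proof (induction rule: sparse_induct)
  case empty
  show ?case by (rule colourable_empty)
next
  case (step E)
  note E = step(1) and k = step(3) and IH = step(4)
  have in_Union: "x \<in> \<Union>E" if "y \<in> nbrs E x" for x y using that by (auto simp: nbrs_def)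
  have adjacent_2_vertices: "colourable (2 * k + 2) 1 E"
    if u: "card (star E u) = 2" "w \<in> nbrs E u" and w: "card (star E w) = 2" for u w
  proof (rule colourable_add_2_vertex[OF E k _ u])
    let ?E = "avoiding E {u}"
    have E': "edge_set ?E" using E by (rule edge_set_avoiding)
    show "colourable (2 * k + 2) 1 ?E" using IH[of u "{u}"] in_Union[OF u(2)] by simp
    show "2 * k + 1 + card (star E w) < 2 * k + 2 + 3" using w by simp
    have uw: "u \<in> nbrs E w" using u(2) nbrs_sym[of u E w] by simp
    have deg_w: "card (star ?E w) < card (star E w)"
      using uw by (intro card_star_avoiding_less[OF E]) auto
    fix t assume t: "\<forall>e\<in>?E. t e \<in> e" "few_out 1 ?E t"
    show "k + card (near ?E t w) < 2 * k + 2"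
      using card_near[OF E' t, of w] deg_w k[of w] w by linarith
  qed (use w in simp)
  obtain x where x: "x \<in> \<Union>E"
    "3 * card (star E x) + (if card (star E x) = 2 then 2 * 1 else 0) < 8 + 1 * card (nbrs2 E x)"
    using exists_undercharged[OF E, of 3 8 1] step(2) by auto
  have le: "card (nbrs2 E x) \<le> card (star E x)" using E by (rule card_nbrs2_le)
  have pos: "0 < card (star E x)" using E x(1) by (rule card_star_pos)
  consider "card (star E x) = 1" | "card (star E x) = 2" "0 < card (nbrs2 E x)"
    | "card (star E x) = 3" "1 < card (nbrs2 E x)"
    using x(2) le pos by (cases "card (star E x) = 2") (simp, linarith)
  then show ?case
  proof cases
    case 1
    then show ?thesis using colourable_add_leaf[OF E k _ 1] IH[of x "{x}"] x(1) by simp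
  next
    case 2
    then obtain w where "w \<in> nbrs2 E x" by (metis card.empty all_not_in_conv less_irrefl)
    then show ?thesis using 2 adjacent_2_vertices[of x w] by (simp add: nbrs2_def)
  next
    case 3
    obtain u where u: "u \<in> nbrs2 E x" using exists_not_in_list[of "[]" "nbrs2 E x"] 3 by auto
    obtain v where v: "v \<in> nbrs2 E x" "v \<noteq> u"
      using exists_not_in_list[of "[u]" "nbrs2 E x"] 3 by auto
    show ?thesis
    proof (cases "u \<in> nbrs E v")
      case True
      then show ?thesis using adjacent_2_vertices[of v u] u v by (simp add: nbrs2_def)
    next
      case False
      have "colourable (2 * k + 2) 1 (avoiding E {u, v, x})"
        using IH[of x "{u, v, x}"] x(1) by simp
      then show ?thesis
        using colourable_add_3_vertex[OF E k 3(1)] u v False by (auto simp: nbrs2_def)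
    qed
  qed
qed

lemma sparse_if_mad_less:
  assumes G: "simple_graph G" and mad: "mad G < 2 * real n / real m" and "0 < m" "0 < n"
  shows "sparse m n (edges G)"
  unfolding sparse_def
proof (intro allI impI)
  fix U :: "'a set" assume U: "finite U \<and> U \<noteq> {}"
  let ?H = "induced_subgraph G U"
  have edges_H: "edges ?H = {e \<in> edges G. e \<subseteq> U}" by (simp add: induced_subgraph_def)
  have H: "simple_graph ?H" "subgraph ?H G"
    using G by (auto simp: simple_graph_def subgraph_def induced_subgraph_def)
  show "m * card {e \<in> edges G. e \<subseteq> U} < n * card U"
  proof (cases "verts ?H = {}")
    case True
    then have "{e \<in> edges G. e \<subseteq> U} = {}"
      using H(1) edges_H by (fastforce simp: simple_graph_def)
    then show ?thesis using U \<open>0 < n\<close> by (simp only:) (simp add: card_gt_0_iff)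
  next
    case False
    have fin: "finite (verts ?H)" "finite (edges ?H)"
      using H(1) finite_edges by (auto simp: simple_graph_def)
    let ?A = "{average_degree H | H. subgraph H G \<and> verts H \<noteq> {}}"
    have "finite ?A" using finite_subgraphs[OF G] by simp
    moreover have "average_degree ?H \<in> ?A" using H False by blast
    ultimately have "average_degree ?H \<le> Max ?A" by (rule Max_ge)
    moreover have "verts G \<noteq> {}" using False by (auto simp: induced_subgraph_def)
    ultimately have avg: "average_degree ?H < 2 * real n / real m"
      using mad by (simp add: mad_def)
    have "card {v \<in> verts ?H. v \<in> e} = 2" if "e \<in> edges ?H" for e
    proof -
      have "{v \<in> verts ?H. v \<in> e} = e" using that H(1) by (auto simp: simple_graph_def)
      then show ?thesis using that H(1) by (simp add: simple_graph_def)
    qed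
    then have "(\<Sum>v\<in>verts ?H. degree ?H v) = 2 * card (edges ?H)"
      unfolding degree_def using fin by (intro sum_multicount) auto
    then have "(\<Sum>v\<in>verts ?H. real (degree ?H v)) = 2 * real (card (edges ?H))"
      by (simp flip: of_nat_sum)
    then have "2 * real (card (edges ?H)) / real (card (verts ?H)) < 2 * real n / real m"
      using avg by (simp add: average_degree_def)
    moreover have "0 < card (verts ?H)" using False fin by (simp add: card_gt_0_iff)
    ultimately have "real m * real (card (edges ?H)) < real n * real (card (verts ?H))"
      using \<open>0 < m\<close> by (simp add: field_simps)
    then have "m * card (edges ?H) < n * card (verts ?H)"
      by (simp flip: of_nat_mult)
    moreover have "card (verts ?H) \<le> card U"
      using U by (intro card_mono) (auto simp: induced_subgraph_def)
    ultimately show ?thesis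
      unfolding edges_H by (meson less_le_trans mult_le_mono2)
  qed
qed

theorem theorem1p2:
  fixes G :: "'a graph"
  assumes "simple_graph G"
  shows "(mad G < 14 / 5 \<longrightarrow> semistrong_chromatic_index G \<le> 2 * max_degree G + 4) \<and>
         (mad G < 8 / 3 \<longrightarrow> semistrong_chromatic_index G \<le> 2 * max_degree G + 2)"
proof -
  have E: "edge_set (edges G)"
    using assms finite_edges[OF assms] by (simp add: edge_set_def simple_graph_def)
  have deg: "card (star (edges G) x) \<le> max_degree G" for x
  proof (cases "x \<in> verts G")
    case True
    have "finite (verts G)" using assms by (simp add: simple_graph_def)
    then have "degree G x \<le> max_degree G" using True by (auto simp: max_degree_def)
    then show ?thesis by (simp add: degree_def star_def)
  next
    case False
    then have "star (edges G) x = {}" using assms by (auto simp: simple_graph_def star_def)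
    then show ?thesis by simp
  qed
  have index: "semistrong_chromatic_index G \<le> K" if "colourable K h (edges G)" for K h
  proof -
    from that obtain t c where "tail_colouring (edges G) t c" "c ` edges G \<subseteq> {..<K}"
      by (auto simp: colourable_def)
    then have "semistrong_edge_coloring G K c" by (rule semistrong_if_tail_colouring[OF assms])
    then show ?thesis
      unfolding semistrong_chromatic_index_def by (intro Least_le exI)
  qed
  show ?thesis
  proof (intro conjI impI)
    assume "mad G < 14 / 5"
    then have "sparse 5 7 (edges G)" using sparse_if_mad_less[OF assms, of 7 5] by simp
    then show "semistrong_chromatic_index G \<le> 2 * max_degree G + 4"
      using index colourable_if_sparse_5_7[OF E _ deg] by blast
  next
    assume "mad G < 8 / 3"
    then have "sparse 3 4 (edges G)" using sparse_if_mad_less[OF assms, of 4 3] by simp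
    then show "semistrong_chromatic_index G \<le> 2 * max_degree G + 2"
      using index colourable_if_sparse_3_4[OF E _ deg] by blast
  qed
qed

end
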